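(* Let $K$ be a simplicial complex, let $n$ be a positive integer, let $K^n$ be the $n$-fold categorical product of $K$ with itself, and for $i\in\{1,\dots,n\}$ let $p_i:K^n\to K$ be the projection to the $i$-th factor. Then $\mathrm{SD}(p_1,\dots,p_n)=\mathrm{TC}_n(K)$.
   Context: Simplicial complexes are abstract simplicial complexes. Two simplicial maps $\varphi,\psi:K\to L$ are contiguous if for every simplex $\{v_0,\dots,v_k\}$ of $K$ the set $\{\varphi(v_0),\dots,\varphi(v_k),\psi(v_0),\dots,\psi(v_k)\}$ is a simplex of $L$. They are in the same contiguity class, written $\varphi\sim\psi$, if there is a finite sequence of simplicial maps $K\to L$ from $\varphi$ to $\psi$ in which consecutive maps are contiguous. For simplicial maps $\varphi_1,\dots,\varphi_n:K\to K'$, the $n$-th contiguity distance $\mathrm{SD}(\varphi_1,\dots,\varphi_n)$ is the least integer $k\ge 0$ such that $K$ is covered by subcomplexes $K_0,\dots,K_k$ with $\varphi_1|_{K_j},\dots,\varphi_n|_{K_j}:K_j\to K'$ all in the same contiguity class for each $j=0,\dots,k$; it is $\infty$ if there is no such covering. The categorical product $K^n$ has vertex set $V(K)^n$, and a finite nonempty set of vertices is a simplex of $K^n$ iff each of its $n$ coordinate projections is a simplex of $K$. A subcomplex $\Omega\subset K^n$ is an $n$-Farber subcomplex if there is a simplicial map $\sigma:\Omega\to K$ such that $\Delta\circ\sigma\sim\iota_\Omega$, where $\Delta:K\to K^n$, $\Delta(v)=(v,\dots,v)$, is the diagonal and $\iota_\Omega:\Omega\hookrightarrow K^n$ is the inclusion.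 The $n$-th discrete topological complexity $\mathrm{TC}_n(K)$ is the least integer $k\ge 0$ such that $K^n$ is covered by $n$-Farber subcomplexes $\Omega_0,\dots,\Omega_k$ ($\infty$ if there is no such covering). *)

theory Defs
  imports Main "HOL-Library.FuncSet" "HOL-Library.Extended_Nat"
begin

text \<open>
  An abstract simplicial complex is given by its set of (finite, nonempty) simplices. Infinite
  complexes and the empty complex are allowed.
\<close>

definition abstract_simplicial_complex :: "'a set set \<Rightarrow> bool" where
  "abstract_simplicial_complex K \<longleftrightarrow>
     (\<forall>s\<in>K. finite s \<and> s \<noteq> {}) \<and> (\<forall>s\<in>K. \<forall>t. t \<noteq> {} \<and> t \<subseteq> s \<longrightarrow> t \<in> K)"

definition vertices :: "'a set set \<Rightarrow> 'a set" where
  "vertices K = \<Union>K"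

definition subcomplex :: "'a set set \<Rightarrow> 'a set set \<Rightarrow> bool" where
  "subcomplex L K \<longleftrightarrow> abstract_simplicial_complex L \<and> L \<subseteq> K"

text \<open>
  A vertex map is a total function of which only the values on the vertices of the domain complex
  matter. Restriction to a subcomplex is therefore expressed by changing the complex and keeping
  the function.
\<close>

definition simplicial_map :: "'a set set \<Rightarrow> 'b set set \<Rightarrow> ('a \<Rightarrow> 'b) \<Rightarrow> bool" where
  "simplicial_map K L f \<longleftrightarrow> (\<forall>s\<in>K. f ` s \<in> L)"

definition contiguous :: "'a set set \<Rightarrow> 'b set set \<Rightarrow> ('a \<Rightarrow> 'b) \<Rightarrow> ('a \<Rightarrow> 'b) \<Rightarrow> bool" where
  "contiguous K L f g \<longleftrightarrow> (\<forall>s\<in>K. f ` s \<union> g ` s \<in> L)"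

text \<open>
  The equations at the two ends are between total functions. This is no restriction: simplicial
  maps that agree on the vertices of \<open>K\<close> are contiguous, so a chain can be prolonged at its ends.
\<close>

definition same_contiguity_class ::
  "'a set set \<Rightarrow> 'b set set \<Rightarrow> ('a \<Rightarrow> 'b) \<Rightarrow> ('a \<Rightarrow> 'b) \<Rightarrow> bool" where
  "same_contiguity_class K L f g \<longleftrightarrow>
     (\<exists>(m::nat) h. h 0 = f \<and> h m = g \<and> (\<forall>i\<le>m. simplicial_map K L (h i)) \<and>
        (\<forall>i<m. contiguous K L (h i) (h (Suc i))))"

text \<open>
  \<open>contiguity_distance n K L \<phi>\<close> is the distance of the maps \<open>\<phi> 1, \<dots>, \<phi> n\<close> from \<open>K\<close> to \<open>L\<close>.
  The infimum of the empty set of extended naturals is \<open>\<infinity>\<close>.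
\<close>

definition contiguity_distance ::
  "nat \<Rightarrow> 'a set set \<Rightarrow> 'b set set \<Rightarrow> (nat \<Rightarrow> 'a \<Rightarrow> 'b) \<Rightarrow> enat" where
  "contiguity_distance n K L \<phi> =
     Inf {enat k | k. \<exists>C :: nat \<Rightarrow> 'a set set.
       (\<forall>j\<le>k. subcomplex (C j) K) \<and> K = (\<Union>j\<le>k. C j) \<and>
       (\<forall>j\<le>k. \<forall>i\<in>{1..n}. \<forall>i'\<in>{1..n}. same_contiguity_class (C j) L (\<phi> i) (\<phi> i'))}"

text \<open>
  Tuples \<open>(v\<^sub>1, \<dots>, v\<^sub>n)\<close> are functions on \<open>{1..n}\<close>, extended by \<^const>\<open>undefined\<close>.
\<close>

definition proj :: "nat \<Rightarrow> (nat \<Rightarrow> 'a) \<Rightarrow> 'a" where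
  "proj i v = v i"

definition categorical_power :: "'a set set \<Rightarrow> nat \<Rightarrow> (nat \<Rightarrow> 'a) set set" where
  "categorical_power K n =
     {S. finite S \<and> S \<noteq> {} \<and> S \<subseteq> ({1..n} \<rightarrow>\<^sub>E vertices K) \<and> (\<forall>i\<in>{1..n}. proj i ` S \<in> K)}"

definition diagonal :: "nat \<Rightarrow> 'a \<Rightarrow> (nat \<Rightarrow> 'a)" where
  "diagonal n v = (\<lambda>i\<in>{1..n}. v)"

definition farber_subcomplex :: "nat \<Rightarrow> 'a set set \<Rightarrow> (nat \<Rightarrow> 'a) set set \<Rightarrow> bool" where
  "farber_subcomplex n K \<Omega> \<longleftrightarrow>
     subcomplex \<Omega> (categorical_power K n) \<and>
     (\<exists>\<sigma>. simplicial_map \<Omega> K \<sigma> \<and>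
        same_contiguity_class \<Omega> (categorical_power K n) (diagonal n \<circ> \<sigma>) id)"

definition discrete_TC :: "nat \<Rightarrow> 'a set set \<Rightarrow> enat" where
  "discrete_TC n K =
     Inf {enat k | k. \<exists>\<Omega> :: nat \<Rightarrow> (nat \<Rightarrow> 'a) set set.
       (\<forall>j\<le>k. farber_subcomplex n K (\<Omega> j)) \<and> categorical_power K n = (\<Union>j\<le>k. \<Omega> j)}"

lemma face_in_complex:
  "abstract_simplicial_complex K \<Longrightarrow> s \<in> K \<Longrightarrow> t \<noteq> {} \<Longrightarrow> t \<subseteq> s \<Longrightarrow> t \<in> K"
  unfolding abstract_simplicial_complex_def by (elim conjE) (drule (1) bspec, erule allE, erule mp, rule conjI)

lemma abstract_simplicial_complex_categorical_power:
  assumes K: "abstract_simplicial_complex K"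
  shows "abstract_simplicial_complex (categorical_power K n)"
  unfolding abstract_simplicial_complex_def
proof (intro conjI ballI allI impI)
  fix S T
  assume S: "S \<in> categorical_power K n" and T: "T \<noteq> {} \<and> T \<subseteq> S"
  have "proj i ` T \<in> K" if "i \<in> {1..n}" for i
  proof (rule face_in_complex[OF K])
    show "proj i ` S \<in> K"
      using S that by (simp add: categorical_power_def)
    show "proj i ` T \<noteq> {}" "proj i ` T \<subseteq> proj i ` S"
      using T by (simp_all add: image_mono)
  qed
  moreover have "finite S" "S \<subseteq> ({1..n} \<rightarrow>\<^sub>E vertices K)"
    using S by (simp_all add: categorical_power_def)
  then have "finite T" "T \<subseteq> ({1..n} \<rightarrow>\<^sub>E vertices K)"
    using T finite_subset[of T S] subset_trans[of T S] by simp_all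
  ultimately show "T \<in> categorical_power K n"
    using T by (simp add: categorical_power_def)
qed (simp_all add: categorical_power_def)

lemma simplicial_map_proj:
  "i \<in> {1..n} \<Longrightarrow> simplicial_map (categorical_power K n) K (proj i)"
  by (simp add: simplicial_map_def categorical_power_def)

lemma simplicial_map_diagonal:
  assumes K: "abstract_simplicial_complex K"
  shows "simplicial_map K (categorical_power K n) (diagonal n)"
  unfolding simplicial_map_def
proof
  fix s
  assume s: "s \<in> K"
  have "proj i ` diagonal n ` s = s" if "i \<in> {1..n}" for i
    using that by (simp add: image_image proj_def diagonal_def)
  moreover have "diagonal n v \<in> {1..n} \<rightarrow>\<^sub>E vertices K" if "v \<in> s" for v
    using that s by (auto simp: diagonal_def vertices_def)
  moreover have "finite s" "s \<noteq> {}"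
    using bspec[OF K[unfolded abstract_simplicial_complex_def, THEN conjunct1] s] by simp_all
  ultimately show "diagonal n ` s \<in> categorical_power K n"
    using s by (simp add: categorical_power_def image_subset_iff)
qed

end

theory Submission
  imports Defs
begin

text \<open>
  Both invariants count the members of a covering of \<open>K\<^sup>n\<close> by subcomplexes, so it suffices that the
  subcomplexes allowed in the two coverings are the same: a subcomplex \<open>\<Omega>\<close> of \<open>K\<^sup>n\<close> is a Farber
  subcomplex iff the projections \<open>p\<^sub>1, \<dots>, p\<^sub>n\<close>, restricted to \<open>\<Omega>\<close>, lie in one contiguity class.

  This equivalence comes from the universal property of the categorical product, which holds for
  contiguity classes as well as for maps. If \<open>\<Delta> \<circ> \<sigma> \<sim> \<iota>\<close>, then composing with \<open>p\<^sub>i\<close> gives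
  \<open>\<sigma> = p\<^sub>i \<circ> \<Delta> \<circ> \<sigma> \<sim> p\<^sub>i\<close> for every \<open>i\<close>, so all the \<open>p\<^sub>i\<close> are in the class of \<open>\<sigma>\<close>
  (\<open>farber_imp_projections_contiguous\<close>). Conversely, let all the \<open>p\<^sub>i\<close> be in the class of \<open>p\<^sub>1\<close>,
  and take \<open>\<sigma> = p\<^sub>1\<close>. The map \<open>\<Delta> \<circ> p\<^sub>1\<close> has all its components equal to \<open>p\<^sub>1\<close>, whereas \<open>\<iota>\<close> has the
  components \<open>p\<^sub>i\<close>. The \<open>n\<close> chains from \<open>p\<^sub>1\<close> to \<open>p\<^sub>i\<close>, run simultaneously, form a chain of maps
  into \<open>K\<^sup>n\<close> from \<open>\<Delta> \<circ> p\<^sub>1\<close> to \<open>\<iota>\<close> (\<open>same_contiguity_class_tuple\<close>).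
\<close>

section \<open>Contiguity classes\<close>

lemma contiguous_refl: "simplicial_map K L f \<Longrightarrow> contiguous K L f f"
  by (simp add: contiguous_def simplicial_map_def)

lemma contiguous_sym: "contiguous K L f g \<Longrightarrow> contiguous K L g f"
  by (simp add: contiguous_def Un_commute)

lemma same_contiguity_class_sym:
  assumes "same_contiguity_class K L f g"
  shows "same_contiguity_class K L g f"
proof -
  obtain m h where h: "h 0 = f" "h m = g" "\<forall>i\<le>m. simplicial_map K L (h i)"
      "\<forall>i<m. contiguous K L (h i) (h (Suc i))"
    using assms by (auto simp: same_contiguity_class_def)
  have "contiguous K L (h (m - i)) (h (m - Suc i))" if "i < m" for i
  proof (rule contiguous_sym)
    have "Suc (m - Suc i) = m - i" "m - Suc i < m"
      using that by simp_all
    then show "contiguous K L (h (m - Suc i)) (h (m - i))"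
      using h(4) by metis
  qed
  then show ?thesis
    unfolding same_contiguity_class_def
    using h by (intro exI[of _ m] exI[of _ "\<lambda>i. h (m - i)"]) simp
qed

lemma same_contiguity_class_step:
  assumes "same_contiguity_class K L f g" "contiguous K L g k" "simplicial_map K L k"
  shows "same_contiguity_class K L f k"
proof -
  obtain m h where h: "h 0 = f" "h m = g" "\<forall>i\<le>m. simplicial_map K L (h i)"
      "\<forall>i<m. contiguous K L (h i) (h (Suc i))"
    using assms(1) by (auto simp: same_contiguity_class_def)
  let ?h = "h(Suc m := k)"
  have "simplicial_map K L (?h i)" if "i \<le> Suc m" for i
    using that h(3) assms(3) by (cases "i = Suc m") simp_all
  moreover have "contiguous K L (?h i) (?h (Suc i))" if "i < Suc m" for i
    using that h(2,4) assms(2) by (cases "i = m") simp_all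
  moreover have "?h 0 = f" "?h (Suc m) = k"
    using h(1) by simp_all
  ultimately show ?thesis
    unfolding same_contiguity_class_def
    by (intro exI[of _ "Suc m"] exI[of _ ?h]) simp
qed

lemma same_contiguity_class_trans:
  assumes "same_contiguity_class K L f g" "same_contiguity_class K L g k"
  shows "same_contiguity_class K L f k"
proof -
  obtain m h where h: "h 0 = g" "h m = k" "\<forall>i\<le>m. simplicial_map K L (h i)"
      "\<forall>i<m. contiguous K L (h i) (h (Suc i))"
    using assms(2) by (auto simp: same_contiguity_class_def)
  have "i \<le> m \<Longrightarrow> same_contiguity_class K L f (h i)" for i
  proof (induction i)
    case 0
    then show ?case using assms(1) h(1) by simp
  next
    case (Suc i)
    show ?case
    proof (rule same_contiguity_class_step)
      show "same_contiguity_class K L f (h i)" using Suc by simp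
      show "contiguous K L (h i) (h (Suc i))" using h(4) Suc.prems by simp
      show "simplicial_map K L (h (Suc i))" using h(3) Suc.prems by simp
    qed
  qed
  from this[of m] show ?thesis using h(2) by simp
qed

lemma same_contiguity_class_comp:
  assumes "same_contiguity_class K L f g" "simplicial_map L M p"
  shows "same_contiguity_class K M (p \<circ> f) (p \<circ> g)"
proof -
  obtain m h where h: "h 0 = f" "h m = g" "\<forall>i\<le>m. simplicial_map K L (h i)"
      "\<forall>i<m. contiguous K L (h i) (h (Suc i))"
    using assms(1) by (auto simp: same_contiguity_class_def)
  have "simplicial_map K M (p \<circ> h i)" if "i \<le> m" for i
    using h(3) that assms(2) unfolding simplicial_map_def image_comp [symmetric] by simp
  moreover have "contiguous K M (p \<circ> h i) (p \<circ> h (Suc i))" if "i < m" for i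
    using h(4) that assms(2)
    unfolding contiguous_def simplicial_map_def image_comp [symmetric] image_Un [symmetric] by simp
  ultimately show ?thesis
    unfolding same_contiguity_class_def
    using h(1,2) by (intro exI[of _ m] exI[of _ "\<lambda>i. p \<circ> h i"]) simp
qed

text \<open>
  A chain can be prolonged by repeating its last map. This is what allows finitely many chains to
  be run simultaneously.
\<close>

lemma contiguity_chain_prolong:
  assumes "\<forall>i\<le>m. simplicial_map K L (h i)" "\<forall>i<m. contiguous K L (h i) (h (Suc i))"
  shows "simplicial_map K L (h (min i m))" "contiguous K L (h (min i m)) (h (min (Suc i) m))"
proof -
  show "simplicial_map K L (h (min i m))"
    using assms(1) by simp
  show "contiguous K L (h (min i m)) (h (min (Suc i) m))"
  proof (cases "i < m")
    case True
    then show ?thesis using assms(2) by (simp add: min_def)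
  next
    case False
    then show ?thesis using assms(1) by (simp add: min_def contiguous_refl)
  qed
qed

section \<open>Maps into a categorical power\<close>

lemma proj_image_tuple:
  "i \<in> {1..n} \<Longrightarrow> proj i ` (\<lambda>x. \<lambda>i\<in>{1..n}. f i x) ` s = f i ` s"
  by (simp add: image_image proj_def)

lemma contiguous_tuple:
  assumes L: "abstract_simplicial_complex L"
    and fg: "\<forall>i\<in>{1..n}. contiguous L K (f i) (g i)"
  shows "contiguous L (categorical_power K n)
    (\<lambda>x. \<lambda>i\<in>{1..n}. f i x) (\<lambda>x. \<lambda>i\<in>{1..n}. g i x)"
  unfolding contiguous_def
proof
  fix s assume s: "s \<in> L"
  let ?F = "\<lambda>x. \<lambda>i\<in>{1..n}. f i x" and ?G = "\<lambda>x. \<lambda>i\<in>{1..n}. g i x"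
  have K: "f i ` s \<union> g i ` s \<in> K" if "i \<in> {1..n}" for i
    using fg s that by (simp add: contiguous_def)
  have "finite s" "s \<noteq> {}"
    using L s by (auto simp: abstract_simplicial_complex_def)
  moreover have "f i x \<in> vertices K" "g i x \<in> vertices K" if "i \<in> {1..n}" "x \<in> s" for i x
    using K[OF that(1)] that(2) unfolding vertices_def by blast+
  then have "?F ` s \<union> ?G ` s \<subseteq> {1..n} \<rightarrow>\<^sub>E vertices K"
    by auto
  moreover have "proj i ` (?F ` s \<union> ?G ` s) \<in> K" if "i \<in> {1..n}" for i
    using K[OF that] unfolding image_Un proj_image_tuple[OF that] .
  ultimately show "?F ` s \<union> ?G ` s \<in> categorical_power K n"
    unfolding categorical_power_def by blast
qed

text \<open>A map is simplicial iff it is contiguous to itself.\<close>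

lemma simplicial_map_tuple:
  assumes "abstract_simplicial_complex L" "\<forall>i\<in>{1..n}. simplicial_map L K (f i)"
  shows "simplicial_map L (categorical_power K n) (\<lambda>x. \<lambda>i\<in>{1..n}. f i x)"
  using contiguous_tuple[OF assms(1), of n K f f] assms(2)
  by (simp add: contiguous_refl) (simp add: contiguous_def simplicial_map_def)

text \<open>
  The half of the universal property of the categorical product that builds a map from its
  components, for contiguity classes. As the simplices of \<open>K\<^sup>n\<close> are detected by their projections,
  componentwise contiguities give a contiguity of tuples (\<open>contiguous_tuple\<close>). It remains to give
  the chains of the \<open>n\<close> components a common length.
\<close>

lemma same_contiguity_class_tuple:
  assumes L: "abstract_simplicial_complex L"
    and fg: "\<forall>i\<in>{1..n}. same_contiguity_class L K (f i) (g i)"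
  shows "same_contiguity_class L (categorical_power K n)
    (\<lambda>x. \<lambda>i\<in>{1..n}. f i x) (\<lambda>x. \<lambda>i\<in>{1..n}. g i x)"
proof -
  have "\<forall>i\<in>{1..n}. \<exists>m h. h 0 = f i \<and> h m = g i \<and> (\<forall>t\<le>m. simplicial_map L K (h t)) \<and>
      (\<forall>t<m. contiguous L K (h t) (h (Suc t)))"
    using fg by (simp add: same_contiguity_class_def)
  then obtain m where "\<forall>i\<in>{1..n}. \<exists>h. h 0 = f i \<and> h (m i) = g i \<and>
      (\<forall>t\<le>m i. simplicial_map L K (h t)) \<and> (\<forall>t<m i. contiguous L K (h t) (h (Suc t)))"
    unfolding bchoice_iff by (rule exE)
  then obtain h where h: "\<forall>i\<in>{1..n}. h i 0 = f i \<and> h i (m i) = g i \<and>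
      (\<forall>t\<le>m i. simplicial_map L K (h i t)) \<and>
      (\<forall>t<m i. contiguous L K (h i t) (h i (Suc t)))"
    unfolding bchoice_iff by (rule exE)
  \<comment> \<open>Any common upper bound of the lengths will do.\<close>
  define M where "M = (\<Sum>i\<in>{1..n}. m i)"
  define H where "H t = (\<lambda>x. \<lambda>i\<in>{1..n}. h i (min t (m i)) x)" for t
  have "m i \<le> M" if "i \<in> {1..n}" for i
    unfolding M_def using that by (intro member_le_sum) simp_all
  then have "H M = (\<lambda>x. \<lambda>i\<in>{1..n}. g i x)"
    unfolding H_def using h by (intro ext restrict_ext) (simp add: min_absorb2)
  moreover have "H 0 = (\<lambda>x. \<lambda>i\<in>{1..n}. f i x)"
    unfolding H_def using h by (intro ext restrict_ext) simp
  moreover have "simplicial_map L (categorical_power K n) (H t)" for t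
    unfolding H_def using h by (intro simplicial_map_tuple[OF L] ballI contiguity_chain_prolong) simp_all
  moreover have "contiguous L (categorical_power K n) (H t) (H (Suc t))" for t
    unfolding H_def using h by (intro contiguous_tuple[OF L] ballI contiguity_chain_prolong) simp_all
  ultimately show ?thesis
    unfolding same_contiguity_class_def
    by (intro exI[of _ M] exI[of _ H]) simp
qed

section \<open>Farber subcomplexes\<close>

lemma simplicial_map_subcomplex:
  "subcomplex \<Omega> K \<Longrightarrow> simplicial_map K L f \<Longrightarrow> simplicial_map \<Omega> L f"
  by (auto simp: subcomplex_def simplicial_map_def)

text \<open>Each \<open>p\<^sub>k\<close> is a left inverse of \<open>\<Delta>\<close>, so composing \<open>\<Delta> \<circ> \<sigma> \<sim> \<iota>\<close> with it gives \<open>\<sigma> \<sim> p\<^sub>k\<close>.\<close>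

lemma farber_imp_projections_contiguous:
  assumes "farber_subcomplex n K \<Omega>" "i \<in> {1..n}" "j \<in> {1..n}"
  shows "same_contiguity_class \<Omega> K (proj i) (proj j)"
proof -
  obtain \<sigma> where \<sigma>: "same_contiguity_class \<Omega> (categorical_power K n) (diagonal n \<circ> \<sigma>) id"
    using assms(1) by (auto simp: farber_subcomplex_def)
  have "same_contiguity_class \<Omega> K \<sigma> (proj k)" if k: "k \<in> {1..n}" for k
  proof -
    have "proj k \<circ> (diagonal n \<circ> \<sigma>) = \<sigma>"
      using k by (simp add: fun_eq_iff proj_def diagonal_def)
    then show ?thesis
      using same_contiguity_class_comp[OF \<sigma> simplicial_map_proj[OF k]] by simp
  qed
  from this[OF assms(2)] this[OF assms(3)] show ?thesis
    by (rule same_contiguity_class_trans[OF same_contiguity_class_sym])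
qed

text \<open>
  With \<open>\<sigma> = p\<^sub>1\<close>, the map \<open>\<Delta> \<circ> \<sigma>\<close> is the tuple \<open>(p\<^sub>1, \<dots>, p\<^sub>1)\<close> and the inclusion is the tuple
  \<open>(p\<^sub>1, \<dots>, p\<^sub>n)\<close>. Here \<open>n > 0\<close> is what makes \<open>p\<^sub>1\<close> a simplicial map.
\<close>

lemma projections_contiguous_imp_farber:
  fixes K :: "'a set set"
  assumes \<Omega>: "subcomplex \<Omega> (categorical_power K n)" and "n > 0"
    and p: "\<forall>i\<in>{1..n}. same_contiguity_class \<Omega> K (proj 1) (proj i)"
  shows "farber_subcomplex n K \<Omega>"
proof -
  let ?\<iota> = "\<lambda>x. \<lambda>i\<in>{1..n}. proj i x"
  have "same_contiguity_class \<Omega> (categorical_power K n) (\<lambda>x. \<lambda>i\<in>{1..n}. proj 1 x) ?\<iota>"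
  proof (rule same_contiguity_class_tuple)
    show "abstract_simplicial_complex \<Omega>"
      using \<Omega> by (simp add: subcomplex_def)
  qed (rule p)
  moreover have "(\<lambda>x :: nat \<Rightarrow> 'a. \<lambda>i\<in>{1..n}. proj 1 x) = diagonal n \<circ> proj 1"
    by (intro ext) (simp add: diagonal_def)
  ultimately have chain:
    "same_contiguity_class \<Omega> (categorical_power K n) (diagonal n \<circ> proj 1) ?\<iota>"
    by (simp only:)
  have id: "simplicial_map \<Omega> (categorical_power K n) id"
    using \<Omega> by (auto simp: simplicial_map_def subcomplex_def)
  \<comment> \<open>The tuple of the projections differs from the identity outside the functions that are
    extended by \<^const>\<open>undefined\<close>, so a last step is needed between these two total functions,
    which agree on the vertices.\<close>
  have "contiguous \<Omega> (categorical_power K n) ?\<iota> id"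
    unfolding contiguous_def
  proof
    fix s assume s: "s \<in> \<Omega>"
    then have "s \<in> categorical_power K n"
      using \<Omega> by (auto simp: subcomplex_def)
    then have "s \<subseteq> {1..n} \<rightarrow>\<^sub>E vertices K"
      by (simp add: categorical_power_def)
    then have "?\<iota> x = x" if "x \<in> s" for x
      using that by (auto simp: proj_def fun_eq_iff PiE_def extensional_def)
    then have "?\<iota> ` s = s"
      by simp
    then show "?\<iota> ` s \<union> id ` s \<in> categorical_power K n"
      using \<open>s \<in> categorical_power K n\<close> by simp
  qed
  from chain this id
  have "same_contiguity_class \<Omega> (categorical_power K n) (diagonal n \<circ> proj 1) id"
    by (rule same_contiguity_class_step)
  moreover have "simplicial_map \<Omega> K (proj 1)"
    using \<open>n > 0\<close> by (intro simplicial_map_subcomplex[OF \<Omega>] simplicial_map_proj) simp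
  ultimately show ?thesis
    using \<Omega> unfolding farber_subcomplex_def by blast
qed

lemma farber_subcomplex_iff_projections_contiguous:
  assumes "n > 0"
  shows "farber_subcomplex n K \<Omega> \<longleftrightarrow>
    subcomplex \<Omega> (categorical_power K n) \<and>
    (\<forall>i\<in>{1..n}. \<forall>j\<in>{1..n}. same_contiguity_class \<Omega> K (proj i) (proj j))"
proof
  assume "farber_subcomplex n K \<Omega>"
  then show "subcomplex \<Omega> (categorical_power K n) \<and>
      (\<forall>i\<in>{1..n}. \<forall>j\<in>{1..n}. same_contiguity_class \<Omega> K (proj i) (proj j))"
    using farber_imp_projections_contiguous[of n K \<Omega>] unfolding farber_subcomplex_def by blast
next
  assume "subcomplex \<Omega> (categorical_power K n) \<and>
      (\<forall>i\<in>{1..n}. \<forall>j\<in>{1..n}. same_contiguity_class \<Omega> K (proj i) (proj j))"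
  moreover have "1 \<in> {1..n}"
    using assms by simp
  ultimately show "farber_subcomplex n K \<Omega>"
    using assms by (intro projections_contiguous_imp_farber) blast+
qed

theorem theorem3p2:
  fixes K :: "'a set set" and n :: nat
  assumes "abstract_simplicial_complex K" and "n > 0"
  shows "contiguity_distance n (categorical_power K n) K proj = discrete_TC n K"
  unfolding contiguity_distance_def discrete_TC_def
    farber_subcomplex_iff_projections_contiguous[OF assms(2)]
  by (simp only: imp_conjR all_conj_distrib conj_ac)

end
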